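(* Let $C\in\mathbb P_n$ and let $R\in\mathbb P_n$ satisfy $0<R<I$. Then $$\lambda\Bigl(RCR+(I-R)C(I-R)+2\bigl(RCR\#(I-R)C(I-R)\bigr)\Bigr)\prec_w\lambda(C).$$
   Context: $\mathbb P_n$ is the set of $n\times n$ complex (Hermitian) positive definite matrices; $X<Y$ for Hermitian matrices means $Y-X$ is positive definite. For a Hermitian matrix $T$, $\lambda(T)$ is the vector of eigenvalues in decreasing order. For $x,y\in\mathbb R^n$ with decreasing rearrangements $x^\downarrow,y^\downarrow$, $x\prec_w y$ means $\sum_{j=1}^k x_j^\downarrow\le\sum_{j=1}^k y_j^\downarrow$ for all $1\le k\le n$. For $P,Q\in\mathbb P_n$, $P\#Q=P^{1/2}(P^{-1/2}QP^{-1/2})^{1/2}P^{1/2}$ is the Kubo-Ando geometric mean; in the claim, $RCR\#(I-R)C(I-R)$ means the geometric mean of the two matrices $RCR$ and $(I-R)C(I-R)$. *)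

theory Defs
  imports
    "Jordan_Normal_Form.Gauss_Jordan_Elimination"
    "Jordan_Normal_Form.Schur_Decomposition"
    "Jordan_Normal_Form.Char_Poly"
begin

definition herm_mats :: "nat \<Rightarrow> complex mat set" where
  "herm_mats n = {A \<in> carrier_mat n n. mat_adjoint A = A}"

(* (A *\<^sub>v v) \<bullet>c v conjugates its second argument, so it is v^* A v. *)
definition pd_mats :: "nat \<Rightarrow> complex mat set" where
  "pd_mats n = {A \<in> herm_mats n.
     \<forall>v \<in> carrier_vec n. v \<noteq> 0\<^sub>v n \<longrightarrow> 0 < Re ((A *\<^sub>v v) \<bullet>c v)}"

definition loewner_less :: "nat \<Rightarrow> complex mat \<Rightarrow> complex mat \<Rightarrow> bool" where
  "loewner_less n X Y \<longleftrightarrow> X \<in> herm_mats n \<and> Y \<in> herm_mats n \<and> Y - X \<in> pd_mats n"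

(* A positive definite matrix has exactly one positive definite square root and is
   invertible; mat_sqrt off this set, and mat_inv on singular matrices, are junk values. *)
definition mat_sqrt :: "nat \<Rightarrow> complex mat \<Rightarrow> complex mat" where
  "mat_sqrt n A = (THE B. B \<in> pd_mats n \<and> B * B = A)"

definition mat_inv :: "complex mat \<Rightarrow> complex mat" where
  "mat_inv A = the (mat_inverse A)"

definition geom_mean :: "nat \<Rightarrow> complex mat \<Rightarrow> complex mat \<Rightarrow> complex mat" where
  "geom_mean n P Q =
     (let S = mat_sqrt n P; T = mat_inv S in S * mat_sqrt n (T * Q * T) * S)"

definition decreasing :: "real list \<Rightarrow> real list" where
  "decreasing xs = rev (sort xs)"

(* The eigenvalues of a Hermitian matrix are real and are listed with multiplicity, as
   roots of the characteristic polynomial; Re only changes the type. *)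
definition eigvals_desc :: "complex mat \<Rightarrow> real list" where
  "eigvals_desc T =
     rev (sorted_list_of_multiset (image_mset Re (proots (char_poly T))))"

(* List positions start at 0, so the sum over j < k has the k largest entries. *)
definition weakly_majorized :: "real list \<Rightarrow> real list \<Rightarrow> bool"  (infix \<open>\<prec>\<^sub>w\<close> 50) where
  "x \<prec>\<^sub>w y \<longleftrightarrow> length x = length y \<and>
     (\<forall>k\<in>{1..length x}. (\<Sum>j<k. decreasing x ! j) \<le> (\<Sum>j<k. decreasing y ! j))"

end

theory Submission
  imports Defs
begin

text \<open>
Put \<open>S = I - R\<close> and \<open>\<Phi>(C) = R C R + S C S + 2 (R C R # S C S)\<close>. The theorem follows from
three properties of \<open>\<Phi>\<close>.

\<^item> \<open>\<Phi>\<close> is monotone in the Loewner order (\<open>mean_compression_mono\<close>).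

\<^item> If \<open>c I \<le> C\<close> with \<open>0 \<le> c\<close>, then \<open>c I \<le> \<Phi>(C)\<close> (\<open>mean_compression_lower_bound\<close>); the reason is
  that \<open>\<Phi>(c I) = c (R + S)\<^sup>2 = c I\<close>.

\<^item> \<open>tr \<Phi>(C) \<le> tr C\<close> (\<open>trace_mean_compression_le\<close>): on a unit eigenvector \<open>v\<close> of \<open>R\<close>, with
  eigenvalue \<open>r\<close>, the quadratic form of \<open>\<Phi>(C)\<close> is at most \<open>(r + (1 - r))\<^sup>2\<close> times that of \<open>C\<close>,
  and these eigenvectors form an orthonormal basis.

The first two rest on the extremal description of the geometric mean: \<open>P # Q\<close> is the largest
Hermitian \<open>X\<close> for which the block matrix with rows \<open>(P, X)\<close> and \<open>(X, Q)\<close> is positive semidefinite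
(\<open>geom_mean_block_nonneg\<close> and \<open>geom_mean_greatest\<close>). The third needs only the semidefiniteness.

To bound the sum of the \<open>k\<close> largest eigenvalues of \<open>\<Phi>(C)\<close>, let \<open>\<lambda>\<^sub>1 \<ge> \<lambda>\<^sub>2 \<ge> \<dots>\<close> be the eigenvalues of \<open>C\<close>,
let \<open>c = \<lambda>\<^sub>k\<close>, and let \<open>C'\<close> arise from \<open>C\<close> by raising every eigenvalue below \<open>c\<close> to \<open>c\<close>. Then
\<open>C \<le> C'\<close> and \<open>c I \<le> C'\<close>. Take an orthonormal eigenbasis of \<open>\<Phi>(C)\<close>, ordered by decreasing eigenvalue. By
monotonicity the sum in question is at most the sum of the first \<open>k\<close> diagonal entries of
\<open>\<Phi>(C')\<close> in this basis. The other \<open>n - k\<close> diagonal entries are at least \<open>c\<close> each, so the sum is at most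
\<open>tr \<Phi>(C') - (n - k) c \<le> tr C' - (n - k) c = \<lambda>\<^sub>1 + \<dots> + \<lambda>\<^sub>k\<close>.

Inequalities between Hermitian matrices are handled throughout as inequalities between quadratic
forms.
\<close>

section \<open>Adjoints and quadratic forms\<close>

lemma mat_adjoint_carrier [simp]: "A \<in> carrier_mat n m \<Longrightarrow> mat_adjoint A \<in> carrier_mat m n"
  by (auto simp: mat_adjoint_def)

lemma mat_adjoint_dim [simp]:
  "dim_row (mat_adjoint A) = dim_col A" "dim_col (mat_adjoint A) = dim_row A"
  by (auto simp: mat_adjoint_def)

lemma mat_adjoint_index [simp]:
  "i < dim_col A \<Longrightarrow> j < dim_row A \<Longrightarrow> mat_adjoint A $$ (i, j) = conjugate (A $$ (j, i))"
  by (simp add: mat_adjoint_def mat_of_rows_def)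

lemma mat_adjoint_mat_adjoint [simp]: "mat_adjoint (mat_adjoint A) = A"
  by (rule eq_matI) auto

lemma mat_adjoint_mult:
  fixes A B :: "complex mat"
  assumes "A \<in> carrier_mat n m" "B \<in> carrier_mat m k"
  shows "mat_adjoint (A * B) = mat_adjoint B * mat_adjoint A"
  using assms by (intro eq_matI) (auto simp: scalar_prod_def mult.commute)

lemma mat_adjoint_add:
  fixes A B :: "complex mat"
  assumes "A \<in> carrier_mat n m" "B \<in> carrier_mat n m"
  shows "mat_adjoint (A + B) = mat_adjoint A + mat_adjoint B"
  using assms by (intro eq_matI) auto

lemma mat_adjoint_minus:
  fixes A B :: "complex mat"
  assumes "A \<in> carrier_mat n m" "B \<in> carrier_mat n m"
  shows "mat_adjoint (A - B) = mat_adjoint A - mat_adjoint B"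
  using assms by (intro eq_matI) auto

lemma mat_adjoint_smult: "mat_adjoint (c \<cdot>\<^sub>m A) = cnj c \<cdot>\<^sub>m mat_adjoint (A :: complex mat)"
  by (intro eq_matI) auto

lemma mat_adjoint_one [simp]: "mat_adjoint (1\<^sub>m n :: complex mat) = 1\<^sub>m n"
  by (intro eq_matI) auto

lemma mat_adjoint_mat_diag_real [simp]:
  "mat_adjoint (mat_diag n (\<lambda>i. complex_of_real (f i))) = mat_diag n (\<lambda>i. complex_of_real (f i))"
  by (intro eq_matI) (auto simp: mat_diag_def)

lemma inner_mat_adjoint:
  fixes A :: "complex mat"
  assumes "A \<in> carrier_mat n m" "v \<in> carrier_vec m" "w \<in> carrier_vec n"
  shows "(A *\<^sub>v v) \<bullet>c w = v \<bullet>c (mat_adjoint A *\<^sub>v w)"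
proof -
  have "(A *\<^sub>v v) \<bullet>c w = (\<Sum>i<n. \<Sum>j<m. A $$ (i, j) * v $ j * cnj (w $ i))"
    using assms by (auto simp: scalar_prod_def atLeast0LessThan sum_distrib_right)
  also have "\<dots> = (\<Sum>j<m. \<Sum>i<n. A $$ (i, j) * v $ j * cnj (w $ i))"
    by (rule sum.swap)
  also have "\<dots> = v \<bullet>c (mat_adjoint A *\<^sub>v w)"
    using assms by (auto simp: scalar_prod_def atLeast0LessThan sum_distrib_left ac_simps)
  finally show ?thesis .
qed

lemma herm_matsD: "A \<in> herm_mats n \<Longrightarrow> A \<in> carrier_mat n n" "A \<in> herm_mats n \<Longrightarrow> mat_adjoint A = A"
  by (auto simp: herm_mats_def)

lemma herm_inner:
  assumes "A \<in> herm_mats n" "v \<in> carrier_vec n" "w \<in> carrier_vec n"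
  shows "(A *\<^sub>v v) \<bullet>c w = v \<bullet>c (A *\<^sub>v w)"
  using assms inner_mat_adjoint[of A n n v w] by (simp add: herm_mats_def)

lemma herm_add: "A \<in> herm_mats n \<Longrightarrow> B \<in> herm_mats n \<Longrightarrow> A + B \<in> herm_mats n"
  by (auto simp: herm_mats_def mat_adjoint_add[of _ n n])

lemma herm_minus: "A \<in> herm_mats n \<Longrightarrow> B \<in> herm_mats n \<Longrightarrow> A - B \<in> herm_mats n"
  by (auto simp: herm_mats_def mat_adjoint_minus[of _ n n] minus_carrier_mat)

lemma herm_smult: "A \<in> herm_mats n \<Longrightarrow> complex_of_real c \<cdot>\<^sub>m A \<in> herm_mats n"
  by (auto simp: herm_mats_def mat_adjoint_smult)

lemma herm_one: "1\<^sub>m n \<in> herm_mats n"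
  by (auto simp: herm_mats_def)

lemma herm_congruence:
  assumes "A \<in> herm_mats n" "M \<in> carrier_mat n m"
  shows "mat_adjoint M * A * M \<in> herm_mats m"
proof -
  have "mat_adjoint (mat_adjoint M * A * M) = mat_adjoint M * mat_adjoint (mat_adjoint M * A)"
    using assms by (intro mat_adjoint_mult[of _ m n]) (auto simp: herm_mats_def)
  also have "mat_adjoint (mat_adjoint M * A) = mat_adjoint A * M"
    using assms mat_adjoint_mult[of "mat_adjoint M" m n A n] by (auto simp: herm_mats_def)
  finally show ?thesis
    using assms assoc_mult_mat[of "mat_adjoint M" m n A n M m] by (auto simp: herm_mats_def)
qed

lemma herm_sandwich:
  assumes "A \<in> herm_mats n" "M \<in> herm_mats n"
  shows "M * A * M \<in> herm_mats n"
  using herm_congruence[of A n M n] assms by (simp add: herm_mats_def)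

definition qform :: "complex mat \<Rightarrow> complex vec \<Rightarrow> real" where
  "qform A v = Re ((A *\<^sub>v v) \<bullet>c v)"

definition sqnorm :: "complex vec \<Rightarrow> real" where
  "sqnorm v = Re (v \<bullet>c v)"

lemma sqnorm_nonneg: "0 \<le> sqnorm v"
  using conjugate_square_ge_0_vec[of v] by (simp add: sqnorm_def less_eq_complex_def)

lemma sqnorm_pos: "v \<in> carrier_vec n \<Longrightarrow> v \<noteq> 0\<^sub>v n \<Longrightarrow> 0 < sqnorm v"
  using conjugate_square_greater_0_vec[of v n] by (simp add: sqnorm_def less_complex_def)

lemma sqnorm_zero [simp]: "sqnorm (0\<^sub>v n) = 0"
  by (simp add: sqnorm_def)

lemma inner_commute_cnj:
  fixes v w :: "complex vec"
  assumes "v \<in> carrier_vec n" "w \<in> carrier_vec n"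
  shows "v \<bullet>c w = cnj (w \<bullet>c v)"
  using assms by (auto simp: scalar_prod_def ac_simps)

lemma Re_inner_commute:
  fixes v w :: "complex vec"
  assumes "v \<in> carrier_vec n" "w \<in> carrier_vec n"
  shows "Re (v \<bullet>c w) = Re (w \<bullet>c v)"
  by (subst inner_commute_cnj[OF assms]) simp

lemma sqnorm_add:
  assumes "v \<in> carrier_vec n" "w \<in> carrier_vec n"
  shows "sqnorm (v + w) = sqnorm v + sqnorm w + 2 * Re (w \<bullet>c v)"
  using assms Re_inner_commute[OF assms]
  by (simp add: sqnorm_def conjugate_add_vec add_scalar_prod_distrib[of _ n]
      scalar_prod_add_distrib[of _ n])

lemma qform_add:
  assumes "A \<in> carrier_mat n n" "B \<in> carrier_mat n n" "v \<in> carrier_vec n"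
  shows "qform (A + B) v = qform A v + qform B v"
  using assms by (simp add: qform_def add_mult_distrib_mat_vec[of _ n n] add_scalar_prod_distrib[of _ n])

lemma qform_minus:
  assumes "A \<in> carrier_mat n n" "B \<in> carrier_mat n n" "v \<in> carrier_vec n"
  shows "qform (A - B) v = qform A v - qform B v"
  using assms by (simp add: qform_def minus_mult_distrib_mat_vec[of _ n n] minus_scalar_prod_distrib[of _ n])

lemma qform_smult:
  assumes "A \<in> carrier_mat n n" "v \<in> carrier_vec n"
  shows "qform (complex_of_real c \<cdot>\<^sub>m A) v = c * qform A v"
proof -
  have "(complex_of_real c \<cdot>\<^sub>m A) *\<^sub>v v = complex_of_real c \<cdot>\<^sub>v (A *\<^sub>v v)"
    using assms by (intro eq_vecI) auto
  then show ?thesis using assms by (simp add: qform_def)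
qed

lemma qform_one [simp]: "v \<in> carrier_vec n \<Longrightarrow> qform (1\<^sub>m n) v = sqnorm v"
  by (simp add: qform_def sqnorm_def)

lemma qform_smult_vec:
  assumes "A \<in> carrier_mat n n" "v \<in> carrier_vec n"
  shows "qform A (complex_of_real c \<cdot>\<^sub>v v) = c\<^sup>2 * qform A v"
  using assms by (simp add: qform_def mult_mat_vec[of _ n n] conjugate_smult_vec power2_eq_square)

lemma sqnorm_smult:
  assumes "v \<in> carrier_vec n"
  shows "sqnorm (complex_of_real c \<cdot>\<^sub>v v) = c\<^sup>2 * sqnorm v"
  using assms qform_smult_vec[of "1\<^sub>m n" n v c] by simp

lemma inner_sandwich:
  assumes "A \<in> carrier_mat n n" "M \<in> herm_mats n" "N \<in> carrier_mat n n"
    "v \<in> carrier_vec n" "w \<in> carrier_vec n"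
  shows "((M * A * N) *\<^sub>v v) \<bullet>c w = (A *\<^sub>v (N *\<^sub>v v)) \<bullet>c (M *\<^sub>v w)"
proof -
  have M: "M \<in> carrier_mat n n" using assms(2) by (rule herm_matsD)
  have "(M * A * N) *\<^sub>v v = M *\<^sub>v (A *\<^sub>v (N *\<^sub>v v))"
    using assms M by (simp add: assoc_mult_mat_vec[of _ n n _ n])
  then show ?thesis
    using assms M by (simp add: herm_inner[OF assms(2)])
qed

lemma qform_sandwich:
  assumes "A \<in> carrier_mat n n" "M \<in> herm_mats n" "v \<in> carrier_vec n"
  shows "qform (M * A * M) v = qform A (M *\<^sub>v v)"
  using assms inner_sandwich[of A n M M v v] by (auto simp: qform_def herm_mats_def)

lemma qform_square:
  assumes "M \<in> herm_mats n" "v \<in> carrier_vec n"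
  shows "qform (M * M) v = sqnorm (M *\<^sub>v v)"
  using qform_sandwich[of "1\<^sub>m n" n M v] assms herm_matsD[OF assms(1)] by simp

definition unitary_mats :: "nat \<Rightarrow> complex mat set" where
  "unitary_mats n = {U \<in> carrier_mat n n. mat_adjoint U * U = 1\<^sub>m n}"

lemma unitaryD:
  assumes "U \<in> unitary_mats n"
  shows "U \<in> carrier_mat n n" "mat_adjoint U * U = 1\<^sub>m n" "U * mat_adjoint U = 1\<^sub>m n"
  using assms mat_mult_left_right_inverse[of "mat_adjoint U" n U] by (auto simp: unitary_mats_def)

lemma unitary_mult:
  assumes "U \<in> unitary_mats n" "V \<in> unitary_mats n"
  shows "U * V \<in> unitary_mats n"
proof -
  note U = unitaryD[OF assms(1)] and V = unitaryD[OF assms(2)]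
  have "mat_adjoint (U * V) * (U * V) = mat_adjoint V * (mat_adjoint U * U) * V"
    using U(1) V(1) 
    by (simp add: mat_adjoint_mult[of _ n n] assoc_mult_mat[of _ n n _ n _ n] mult_carrier_mat[of _ n n _ n])
  also have "\<dots> = 1\<^sub>m n" using U V by simp
  finally show ?thesis using U V by (simp add: unitary_mats_def)
qed

section \<open>The spectral theorem\<close>

lemma unitary_iff_orthonormal_cols:
  assumes "U \<in> carrier_mat n n"
  shows "U \<in> unitary_mats n \<longleftrightarrow>
    (\<forall>i<n. \<forall>j<n. col U i \<bullet>c col U j = (if i = j then 1 else 0))"
proof -
  have entry: "(mat_adjoint U * U) $$ (j, i) = col U i \<bullet>c col U j" if "i < n" "j < n" for i j
    using assms that by (auto simp: scalar_prod_def ac_simps)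
  have "U \<in> unitary_mats n \<longleftrightarrow> mat_adjoint U * U = 1\<^sub>m n"
    using assms by (simp add: unitary_mats_def)
  also have "\<dots> \<longleftrightarrow> (\<forall>j<n. \<forall>i<n. (mat_adjoint U * U) $$ (j, i) = (if j = i then 1 else 0))"
  proof
    assume "\<forall>j<n. \<forall>i<n. (mat_adjoint U * U) $$ (j, i) = (if j = i then 1 else 0)"
    then show "mat_adjoint U * U = 1\<^sub>m n"
      using assms by (intro eq_matI) (auto simp del: index_mult_mat(1))
  qed simp
  also have "\<dots> \<longleftrightarrow> (\<forall>i<n. \<forall>j<n. col U i \<bullet>c col U j = (if i = j then 1 else 0))"
    using entry by metis
  finally show ?thesis .
qed

lemma inner_self: "v \<bullet>c v = complex_of_real (sqnorm v)"
proof -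
  have "Im (v \<bullet>c v) = 0"
    using conjugate_square_ge_0_vec[of v] by (simp add: less_eq_complex_def)
  then show ?thesis by (simp add: sqnorm_def complex_eq_iff)
qed

text \<open>Gram-Schmidt applied to a completion of \<open>v\<close> to a basis keeps the first vector; it
  remains to divide each vector by its length.\<close>
lemma exists_unitary_with_first_col:
  fixes v :: "complex vec"
  assumes v: "v \<in> carrier_vec n" and v0: "v \<noteq> 0\<^sub>v n"
  shows "\<exists>U \<in> unitary_mats n. \<exists>c. col U 0 = c \<cdot>\<^sub>v v"
proof -
  interpret cof_vec_space n "TYPE(complex)" .
  define ws where "ws = gram_schmidt n (basis_completion v)"
  note bc = basis_completion[OF v v0]
  note gs = gram_schmidt_result[OF bc(2,4,5) ws_def]
  have len: "length ws = n" using gs(4) bc(6) by simp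
  have n: "n \<noteq> 0" using v v0 by auto
  have car: "ws ! i \<in> carrier_vec n" if "i < n" for i
    using gs(3) len that nth_mem by blast
  obtain bs where bs: "basis_completion v = v # bs"
    using bc(6,7) n by (cases "basis_completion v") auto
  have "hd ws = v"
    unfolding ws_def bs by (rule gram_schmidt_hd[OF v])
  then have ws0: "ws ! 0 = v" using len n by (cases ws) auto
  have orth: "(ws ! i \<bullet>c ws ! j = 0) = (i \<noteq> j)" if "i < n" "j < n" for i j
    using corthogonalD[OF gs(2)] that len by simp
  define s where "s i = complex_of_real (1 / sqrt (sqnorm (ws ! i)))" for i
  define U where "U = mat n n (\<lambda>(i, j). s j * ws ! j $ i)"
  have U: "U \<in> carrier_mat n n" by (simp add: U_def)
  have col: "col U j = s j \<cdot>\<^sub>v ws ! j" if "j < n" for j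
    using that car[OF that] by (intro eq_vecI) (auto simp: U_def)
  have "col U i \<bullet>c col U j = (if i = j then 1 else 0)" if ij: "i < n" "j < n" for i j
  proof -
    have "col U i \<bullet>c col U j = s i * cnj (s j) * (ws ! i \<bullet>c ws ! j)"
      using car[OF ij(1)] car[OF ij(2)] by (simp add: col ij conjugate_smult_vec)
    also have "\<dots> = (if i = j then 1 else 0)"
    proof (cases "i = j")
      case True
      have "sqnorm (ws ! j) \<noteq> 0"
        using orth[OF ij(2,2)] inner_self[of "ws ! j"] by auto
      then have "sqnorm (ws ! j) > 0" using sqnorm_nonneg[of "ws ! j"] by simp
      then show ?thesis
        using True by (simp add: s_def inner_self flip: of_real_mult)
    qed (use orth[OF ij] in simp)
    finally show ?thesis .
  qed
  then have "U \<in> unitary_mats n"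
    using unitary_iff_orthonormal_cols[OF U] by simp
  moreover have "col U 0 = s 0 \<cdot>\<^sub>v v" using col[of 0] n ws0 by simp
  ultimately show ?thesis by blast
qed

lemma unitary_block:
  assumes "V \<in> unitary_mats m"
  shows "four_block_mat (1\<^sub>m 1) (0\<^sub>m 1 m) (0\<^sub>m m 1) V \<in> unitary_mats (Suc m)"
    (is "?W \<in> _")
proof -
  note V = unitaryD[OF assms]
  have adj: "mat_adjoint ?W = four_block_mat (1\<^sub>m 1) (0\<^sub>m 1 m) (0\<^sub>m m 1) (mat_adjoint V)"
    using V(1) by (intro eq_matI) auto
  have "mat_adjoint ?W * ?W = four_block_mat (1\<^sub>m 1) (0\<^sub>m 1 m) (0\<^sub>m m 1) (1\<^sub>m m)"
    unfolding adj using V(1,2)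
    by (subst mult_four_block_mat[of _ 1 1 _ m _ m _ _ 1 _ m]) auto
  also have "\<dots> = 1\<^sub>m (Suc m)" by (intro eq_matI) auto
  finally show ?thesis using V(1) by (auto simp: unitary_mats_def)
qed

text \<open>If the first basis vector is an eigenvector, its orthogonal complement is invariant
  too, because the first row is the conjugate of the first column. This is the step that splits off
  one eigenvalue in the spectral theorem.\<close>
lemma hermitian_eigenvector_deflation:
  assumes B: "B \<in> herm_mats (Suc m)" and col0: "col B 0 = e \<cdot>\<^sub>v unit_vec (Suc m) 0"
  obtains A1 where "A1 \<in> herm_mats m"
    "B = four_block_mat (mat 1 1 (\<lambda>_. e)) (0\<^sub>m 1 m) (0\<^sub>m m 1) A1"
proof
  note Bc = herm_matsD(1)[OF B]
  define A1 where "A1 = mat m m (\<lambda>(i, j). B $$ (Suc i, Suc j))"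
  have sym: "B $$ (i, j) = cnj (B $$ (j, i))" if "i < Suc m" "j < Suc m" for i j
    using that Bc mat_adjoint_index[of i B j] herm_matsD(2)[OF B] by simp
  have Bi0: "B $$ (i, 0) = (if i = 0 then e else 0)" if "i < Suc m" for i
  proof -
    have "B $$ (i, 0) = col B 0 $ i" using that Bc by simp
    then show ?thesis using that unfolding col0 by simp
  qed
  have B0i: "B $$ (0, i) = 0" if "i < Suc m" "i \<noteq> 0" for i
    using sym[of 0 i] Bi0[of i] that by simp
  show "A1 \<in> herm_mats m"
  proof -
    have "mat_adjoint A1 = A1"
      by (rule eq_matI) (auto simp: A1_def sym[symmetric])
    then show ?thesis by (simp add: herm_mats_def A1_def)
  qed
  show "B = four_block_mat (mat 1 1 (\<lambda>_. e)) (0\<^sub>m 1 m) (0\<^sub>m m 1) A1"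
    using Bc by (intro eq_matI) (auto simp: A1_def Bi0 B0i)
qed

text \<open>Induction on the list of roots: rotate an eigenvector for the first root into the
  first coordinate, split it off, and diagonalize the remaining block. The order of the eigenvalues
  on the diagonal is prescribed by the factorization of the characteristic polynomial, so any order may
  be requested.\<close>
theorem hermitian_spectral_decomposition:
  assumes "A \<in> herm_mats n" and "char_poly A = (\<Prod>e\<leftarrow>es. [:- e, 1:])"
  shows "\<exists>U \<in> unitary_mats n. A = U * mat_diag n (\<lambda>i. es ! i) * mat_adjoint U"
  using assms
proof (induction es arbitrary: n A)
  case Nil
  have "n = 0"
    using degree_monic_char_poly[of A n] herm_matsD(1)[OF Nil(1)] Nil(2) by simp
  with herm_matsD(1)[OF Nil(1)] show ?case
    by (intro bexI[of _ "1\<^sub>m n"]) (auto simp: unitary_mats_def)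
next
  case (Cons e es)
  note A = herm_matsD[OF Cons.prems(1)]
  have "eigenvalue A e"
    using Cons.prems(2) by (simp add: eigenvalue_root_char_poly[OF A(1)])
  then obtain v where v: "v \<in> carrier_vec n" "v \<noteq> 0\<^sub>v n" and ev: "A *\<^sub>v v = e \<cdot>\<^sub>v v"
    using A(1) by (auto simp: eigenvalue_def eigenvector_def)
  have "n \<noteq> 0" using v by auto
  then obtain m where n: "n = Suc m" by (cases n) auto
  obtain U c where U: "U \<in> unitary_mats n" and U0: "col U 0 = c \<cdot>\<^sub>v v"
    using exists_unitary_with_first_col[OF v] by blast
  note U' = unitaryD[OF U]
  define B where "B = mat_adjoint U * A * U"
  have B: "B \<in> herm_mats n"
    unfolding B_def by (rule herm_congruence[OF Cons.prems(1) U'(1)])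
  have "0 < n" using \<open>n \<noteq> 0\<close> by simp
  have AU: "A * U \<in> carrier_mat n n" using A(1) U'(1) by (rule mult_carrier_mat)
  have Ua: "mat_adjoint U \<in> carrier_mat n n" using U'(1) by simp
  have "B = mat_adjoint U * (A * U)"
    unfolding B_def by (rule assoc_mult_mat[OF Ua A(1) U'(1)])
  then have "col B 0 = mat_adjoint U *\<^sub>v (A *\<^sub>v col U 0)"
    by (simp only: col_mult2[OF Ua AU \<open>0 < n\<close>] col_mult2[OF A(1) U'(1) \<open>0 < n\<close>])
  also have "A *\<^sub>v col U 0 = e \<cdot>\<^sub>v col U 0"
    using A(1) v ev by (simp add: U0 mult_mat_vec[of _ n n] smult_smult_assoc mult.commute)
  also have "mat_adjoint U *\<^sub>v (e \<cdot>\<^sub>v col U 0) = e \<cdot>\<^sub>v col (mat_adjoint U * U) 0"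
    using U'(1) \<open>0 < n\<close> by (simp add: mult_mat_vec[OF Ua] col_mult2[OF Ua U'(1)])
  also have "\<dots> = e \<cdot>\<^sub>v unit_vec n 0" using U'(2) n by simp
  finally have col0: "col B 0 = e \<cdot>\<^sub>v unit_vec n 0" .
  obtain A1 where A1: "A1 \<in> herm_mats m"
    and Bblock: "B = four_block_mat (mat 1 1 (\<lambda>_. e)) (0\<^sub>m 1 m) (0\<^sub>m m 1) A1"
    using hermitian_eigenvector_deflation B col0 n by metis
  have A_eq: "A = U * B * mat_adjoint U"
  proof -
    have "U * B * mat_adjoint U = (U * mat_adjoint U) * A * (U * mat_adjoint U)"
      using U'(1) A(1) unfolding B_def
      by (simp add: assoc_mult_mat[of _ n n _ n _ n] mult_carrier_mat[of _ n n _ n])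
    then show ?thesis using U' A by simp
  qed
  have "similar_mat A B"
    using U' A(1) herm_matsD(1)[OF B] A_eq by (intro similar_matI[of _ _ U "mat_adjoint U" n]) auto
  then have "char_poly A = char_poly B" by (rule char_poly_similar)
  also have "\<dots> = char_poly (mat 1 1 (\<lambda>_. e)) * char_poly A1"
    unfolding Bblock using herm_matsD(1)[OF A1] by (intro char_poly_four_block_zeros_col) auto
  also have "char_poly (mat 1 1 (\<lambda>_. e)) = [:- e, 1:]"
    by (simp add: char_poly_defs det_def sign_def)
  finally have "char_poly A1 = (\<Prod>e\<leftarrow>es. [:- e, 1:])"
    using Cons.prems(2) by (simp del: mult_pCons_left)
  from Cons.IH[OF A1 this] obtain V where V: "V \<in> unitary_mats m"
    and A1_eq: "A1 = V * mat_diag m (\<lambda>i. es ! i) * mat_adjoint V" by blast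
  note V' = unitaryD[OF V]
  define W where "W = four_block_mat (1\<^sub>m 1) (0\<^sub>m 1 m) (0\<^sub>m m 1) V"
  have W: "W \<in> unitary_mats n" unfolding W_def n by (rule unitary_block[OF V])
  note W' = unitaryD[OF W]
  have adjW: "mat_adjoint W = four_block_mat (1\<^sub>m 1) (0\<^sub>m 1 m) (0\<^sub>m m 1) (mat_adjoint V)"
    unfolding W_def using V'(1) by (intro eq_matI) auto
  have diag: "mat_diag n (\<lambda>i. (e # es) ! i)
      = four_block_mat (mat 1 1 (\<lambda>_. e)) (0\<^sub>m 1 m) (0\<^sub>m m 1) (mat_diag m (\<lambda>i. es ! i))"
    unfolding n by (intro eq_matI) (auto simp: mat_diag_def nth_Cons')
  have WD: "W * mat_diag n (\<lambda>i. (e # es) ! i)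
      = four_block_mat (mat 1 1 (\<lambda>_. e)) (0\<^sub>m 1 m) (0\<^sub>m m 1) (V * mat_diag m (\<lambda>i. es ! i))"
    unfolding W_def diag using V'(1)
    by (subst mult_four_block_mat[of _ 1 1 _ m _ m _ _ 1 _ m])
       (auto simp: mult_carrier_mat[of _ m m _ m] left_mult_zero_mat[of _ m m]
         right_mult_zero_mat[of _ m m] simp del: One_nat_def)
  have B_eq: "B = W * mat_diag n (\<lambda>i. (e # es) ! i) * mat_adjoint W"
    unfolding WD unfolding adjW Bblock A1_eq using V'(1)
    by (subst mult_four_block_mat[of _ 1 1 _ m _ m _ _ 1 _ m])
       (auto simp: mult_carrier_mat[of _ m m _ m] left_mult_zero_mat[of _ m m]
         right_mult_zero_mat[of _ m m] simp del: One_nat_def)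
  have "A = (U * W) * mat_diag n (\<lambda>i. (e # es) ! i) * mat_adjoint (U * W)"
    unfolding A_eq B_eq using U'(1) W'(1)
    by (simp add: mat_adjoint_mult[of _ n n] assoc_mult_mat[of _ n n _ n _ n]
        mult_carrier_mat[of _ n n _ n])
  then show ?case using unitary_mult[OF U W] by blast
qed

section \<open>Functional calculus\<close>

text \<open>The functional calculus: if \<open>f\<close> lists the eigenvalues of a Hermitian matrix with eigenbasis
  \<open>U\<close>, a function \<open>\<phi>\<close> of that matrix is obtained by replacing \<open>f\<close> with \<open>\<phi> \<circ> f\<close>.\<close>
definition spectral_mat :: "nat \<Rightarrow> complex mat \<Rightarrow> (nat \<Rightarrow> real) \<Rightarrow> complex mat" where
  "spectral_mat n U f = U * mat_diag n (\<lambda>i. complex_of_real (f i)) * mat_adjoint U"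

lemma spectral_mat_herm:
  assumes "U \<in> unitary_mats n"
  shows "spectral_mat n U f \<in> herm_mats n"
proof -
  have "mat_diag n (\<lambda>i. complex_of_real (f i)) \<in> herm_mats n" by (simp add: herm_mats_def)
  from herm_congruence[OF this, of "mat_adjoint U" n] unitaryD(1)[OF assms]
  show ?thesis by (simp add: spectral_mat_def)
qed

lemma spectral_mat_mult_vec:
  assumes U: "U \<in> unitary_mats n" and v: "v \<in> carrier_vec n"
  shows "spectral_mat n U f *\<^sub>v v
    = U *\<^sub>v vec n (\<lambda>i. complex_of_real (f i) * (mat_adjoint U *\<^sub>v v) $ i)"
proof -
  let ?D = "mat_diag n (\<lambda>i. complex_of_real (f i))"
  note U' = unitaryD[OF U]
  define w where "w = mat_adjoint U *\<^sub>v v"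
  have w: "w \<in> carrier_vec n" using U'(1) v by (auto simp: w_def intro: mult_mat_vec_carrier[of _ n n])
  have "?D *\<^sub>v w = vec n (\<lambda>i. complex_of_real (f i) * w $ i)"
  proof (rule eq_vecI)
    fix i assume i: "i < dim_vec (vec n (\<lambda>i. complex_of_real (f i) * w $ i))"
    have "(?D *\<^sub>v w) $ i = (\<Sum>j<n. (if i = j then complex_of_real (f j) else 0) * w $ j)"
      using i w by (auto simp: scalar_prod_def mat_diag_def atLeast0LessThan)
    also have "\<dots> = (\<Sum>j<n. if i = j then complex_of_real (f j) * w $ j else 0)"
      by (rule sum.cong) auto
    finally show "(?D *\<^sub>v w) $ i = vec n (\<lambda>i. complex_of_real (f i) * w $ i) $ i"
      using i by simp
  qed (simp add: mat_diag_def)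
  then show ?thesis
    using U'(1) v by (simp add: spectral_mat_def w_def assoc_mult_mat_vec[of _ n n _ n]
        mult_carrier_mat[of _ n n _ n] mult_mat_vec_carrier[of _ n n])
qed

lemma spectral_mat_mult:
  assumes "U \<in> unitary_mats n"
  shows "spectral_mat n U f * spectral_mat n U g = spectral_mat n U (\<lambda>i. f i * g i)"
proof -
  let ?D = "\<lambda>f. mat_diag n (\<lambda>i. complex_of_real (f i))"
  note U = unitaryD[OF assms]
  have "spectral_mat n U f * spectral_mat n U g
      = U * (?D f * ((mat_adjoint U * U) * ?D g)) * mat_adjoint U"
    using U(1) by (simp add: spectral_mat_def assoc_mult_mat[of _ n n _ n _ n]
        mult_carrier_mat[of _ n n _ n] del: mat_diag_diag)
  also have "?D f * ((mat_adjoint U * U) * ?D g) = ?D (\<lambda>i. f i * g i)"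
    by (simp add: U(2) left_mult_one_mat[of _ n n])
  finally show ?thesis by (simp add: spectral_mat_def)
qed

lemma spectral_mat_one:
  assumes "U \<in> unitary_mats n" "\<And>i. i < n \<Longrightarrow> f i = 1"
  shows "spectral_mat n U f = 1\<^sub>m n"
proof -
  have "mat_diag n (\<lambda>i. complex_of_real (f i)) = 1\<^sub>m n"
    using assms(2) by (intro eq_matI) (auto simp: mat_diag_def)
  then show ?thesis using unitaryD[OF assms(1)] by (simp add: spectral_mat_def)
qed

text \<open>In the coordinates given by the columns of \<open>U\<close> the form is a weighted sum of squares.
  Comparisons between functions of one Hermitian matrix thus reduce to comparisons of the weights.\<close>
lemma qform_spectral_mat:
  assumes U: "U \<in> unitary_mats n" and v: "v \<in> carrier_vec n"
  shows "qform (spectral_mat n U f) v = (\<Sum>i<n. f i * (cmod ((mat_adjoint U *\<^sub>v v) $ i))\<^sup>2)"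
proof -
  note U' = unitaryD[OF U]
  define w where "w = mat_adjoint U *\<^sub>v v"
  have w: "w \<in> carrier_vec n" using U'(1) v by (auto simp: w_def intro: mult_mat_vec_carrier[of _ n n])
  have "(spectral_mat n U f *\<^sub>v v) \<bullet>c v = vec n (\<lambda>i. complex_of_real (f i) * w $ i) \<bullet>c w"
    using U'(1) v by (simp add: spectral_mat_mult_vec[OF U v] inner_mat_adjoint[of _ n n] w_def)
  also have "\<dots> = (\<Sum>i<n. complex_of_real (f i) * (w $ i * cnj (w $ i)))"
    using w by (auto simp: scalar_prod_def atLeast0LessThan ac_simps)
  also have "\<dots> = complex_of_real (\<Sum>i<n. f i * (cmod (w $ i))\<^sup>2)"
    by (simp flip: complex_norm_square)
  finally show ?thesis by (simp add: qform_def w_def)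
qed

lemma sqnorm_unitary_coords:
  assumes "U \<in> unitary_mats n" "v \<in> carrier_vec n"
  shows "sqnorm v = (\<Sum>i<n. (cmod ((mat_adjoint U *\<^sub>v v) $ i))\<^sup>2)"
  using qform_spectral_mat[OF assms, of "\<lambda>_. 1"] spectral_mat_one[OF assms(1), of "\<lambda>_. 1"] assms(2)
  by simp

lemma unitary_col_carrier: "U \<in> unitary_mats n \<Longrightarrow> i < n \<Longrightarrow> col U i \<in> carrier_vec n"
  using unitaryD(1) by auto

lemma sqnorm_unitary_col: "U \<in> unitary_mats n \<Longrightarrow> i < n \<Longrightarrow> sqnorm (col U i) = 1"
  using unitary_iff_orthonormal_cols[of U n] unitaryD(1)[of U n] by (simp add: sqnorm_def)

lemma spectral_mat_eigenvector:
  assumes U: "U \<in> unitary_mats n" and i: "i < n"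
  shows "spectral_mat n U f *\<^sub>v col U i = complex_of_real (f i) \<cdot>\<^sub>v col U i"
proof -
  note U' = unitaryD[OF U]
  have "mat_adjoint U *\<^sub>v col U i = unit_vec n i"
    using U' i by (simp flip: col_mult2[of _ n n _ n])
  then have "spectral_mat n U f *\<^sub>v col U i = U *\<^sub>v (complex_of_real (f i) \<cdot>\<^sub>v unit_vec n i)"
    unfolding spectral_mat_mult_vec[OF U unitary_col_carrier[OF U i]]
    by (intro arg_cong[of _ _ "\<lambda>x. U *\<^sub>v x"] eq_vecI) (auto simp: i)
  also have "\<dots> = complex_of_real (f i) \<cdot>\<^sub>v col U i"
    using U'(1) i by (intro eq_vecI) (auto simp: mult_mat_vec[of _ n n])
  finally show ?thesis .
qed

lemma qform_eigenvector:
  "A *\<^sub>v v = complex_of_real c \<cdot>\<^sub>v v \<Longrightarrow> qform A v = c * sqnorm v"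
  by (simp add: qform_def sqnorm_def)

lemma qform_spectral_mat_col:
  assumes "U \<in> unitary_mats n" "i < n"
  shows "qform (spectral_mat n U f) (col U i) = f i"
  using qform_eigenvector[OF spectral_mat_eigenvector[OF assms]] sqnorm_unitary_col[OF assms]
  by simp

text \<open>A spectral decomposition whose eigenvalues come in the order of \<open>eigvals_desc\<close>. A first
  decomposition, with the roots in an arbitrary order, shows that the roots are real; after that the
  sorted list is a rearrangement of the roots and can be prescribed for a second decomposition.\<close>
lemma eigvals_desc_spectral:
  assumes A: "A \<in> herm_mats n"
  shows "length (eigvals_desc A) = n" "sorted_wrt (\<ge>) (eigvals_desc A)"
    "\<exists>U \<in> unitary_mats n. A = spectral_mat n U (\<lambda>i. eigvals_desc A ! i)"
proof -
  note Ac = herm_matsD[OF A]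
  obtain as where as: "char_poly A = (\<Prod>a\<leftarrow>as. [:- a, 1:])" and len: "length as = n"
    using char_poly_factorized[OF Ac(1)] by blast
  obtain V where V: "V \<in> unitary_mats n" and AV: "A = V * mat_diag n (\<lambda>i. as ! i) * mat_adjoint V"
    using hermitian_spectral_decomposition[OF A as] by blast
  note V' = unitaryD[OF V]
  have "mat_diag n (\<lambda>i. as ! i) = (mat_adjoint V * V) * mat_diag n (\<lambda>i. as ! i) * (mat_adjoint V * V)"
    unfolding V'(2) by (simp add: left_mult_one_mat[of _ n n] right_mult_one_mat[of _ n n])
  also have "\<dots> = mat_adjoint V * A * V"
    unfolding AV using V'(1)
    by (simp add: assoc_mult_mat[of _ n n _ n _ n] mult_carrier_mat[of _ n n _ n])
  finally have D: "mat_diag n (\<lambda>i. as ! i) \<in> herm_mats n"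
    using herm_congruence[OF A V'(1)] by simp
  have real: "complex_of_real (Re (as ! i)) = as ! i" if "i < n" for i
  proof -
    have "cnj (as ! i) = as ! i"
      using that arg_cong[OF herm_matsD(2)[OF D], of "\<lambda>M. M $$ (i, i)"]
      by (simp add: mat_diag_def)
    then show ?thesis by (simp add: complex_eq_iff)
  qed
  have ev: "eigvals_desc A = rev (sort (map Re as))"
  proof -
    have "proots (\<Prod>a\<leftarrow>bs. [:- a, 1:]) = mset bs" for bs :: "complex list"
    proof (induction bs)
      case (Cons b bs)
      have "(\<Prod>a\<leftarrow>bs. [:- a, 1:]) \<noteq> 0" by auto
      then show ?case using Cons by (simp add: proots_mult del: mult_pCons_left)
    qed simp
    then have "proots (char_poly A) = mset as" by (simp only: as)
    then have "image_mset Re (proots (char_poly A)) = mset (map Re as)" by simp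
    then show ?thesis by (simp only: eigvals_desc_def sorted_list_of_multiset_mset)
  qed
  show length: "length (eigvals_desc A) = n" by (simp add: ev len)
  show "sorted_wrt (\<ge>) (eigvals_desc A)" by (simp add: ev sorted_wrt_rev)
  define es where "es = map complex_of_real (eigvals_desc A)"
  have "mset es = mset (map (\<lambda>a. complex_of_real (Re a)) as)"
    by (simp add: es_def ev multiset.map_comp o_def)
  also have "map (\<lambda>a. complex_of_real (Re a)) as = as"
    using real len by (intro nth_equalityI) auto
  finally have mset: "mset es = mset as" .
  have "char_poly A = (\<Prod>e\<leftarrow>es. [:- e, 1:])"
    unfolding as by (simp only: mset flip: prod_mset_prod_list mset_map) (simp add: mset)
  then obtain U where U: "U \<in> unitary_mats n" and "A = U * mat_diag n (\<lambda>i. es ! i) * mat_adjoint U"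
    using hermitian_spectral_decomposition[OF A] by blast
  moreover have "mat_diag n (\<lambda>i. es ! i) = mat_diag n (\<lambda>i. complex_of_real (eigvals_desc A ! i))"
    using length by (intro eq_matI) (auto simp: mat_diag_def es_def)
  ultimately show "\<exists>U \<in> unitary_mats n. A = spectral_mat n U (\<lambda>i. eigvals_desc A ! i)"
    by (auto simp: spectral_mat_def)
qed

lemma hermitian_spectral_mat:
  assumes "A \<in> herm_mats n"
  obtains U f where "U \<in> unitary_mats n" "A = spectral_mat n U f"
  using eigvals_desc_spectral(3)[OF assms] by blast

text \<open>The trace does not depend on the orthonormal basis; this links the eigenbases of \<open>R\<close>, of
  \<open>C\<close> and of the transformed matrix.\<close>
lemma trace_unitary_basis:
  assumes A: "A \<in> carrier_mat n n" and U: "U \<in> unitary_mats n"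
  shows "(\<Sum>i<n. qform A (col U i)) = Re (\<Sum>j<n. A $$ (j, j))"
proof -
  note U' = unitaryD[OF U]
  have UU: "(\<Sum>i<n. U $$ (k, i) * cnj (U $$ (j, i))) = (if k = j then 1 else 0)"
    if "j < n" "k < n" for j k
  proof -
    have "(U * mat_adjoint U) $$ (k, j) = (\<Sum>i<n. U $$ (k, i) * cnj (U $$ (j, i)))"
      using U'(1) that by (auto simp: scalar_prod_def atLeast0LessThan)
    then show ?thesis using U'(3) that by simp
  qed
  have "(\<Sum>i<n. (A *\<^sub>v col U i) \<bullet>c col U i)
      = (\<Sum>i<n. \<Sum>j<n. \<Sum>k<n. A $$ (j, k) * (U $$ (k, i) * cnj (U $$ (j, i))))"
    using A U'(1) by (intro sum.cong)
      (auto simp: scalar_prod_def atLeast0LessThan sum_distrib_right sum_distrib_left ac_simps)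
  also have "\<dots> = (\<Sum>j<n. \<Sum>i<n. \<Sum>k<n. A $$ (j, k) * (U $$ (k, i) * cnj (U $$ (j, i))))"
    by (rule sum.swap)
  also have "\<dots> = (\<Sum>j<n. \<Sum>k<n. \<Sum>i<n. A $$ (j, k) * (U $$ (k, i) * cnj (U $$ (j, i))))"
    by (intro sum.cong refl sum.swap)
  also have "\<dots> = (\<Sum>j<n. \<Sum>k<n. if k = j then A $$ (j, k) else 0)"
    by (intro sum.cong refl) (auto simp: UU simp flip: sum_distrib_left)
  also have "\<dots> = (\<Sum>j<n. A $$ (j, j))" by simp
  finally show ?thesis by (simp add: qform_def flip: Re_sum)
qed

section \<open>The Loewner order and square roots\<close>

definition form_le :: "nat \<Rightarrow> complex mat \<Rightarrow> complex mat \<Rightarrow> bool" where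
  "form_le n A B \<longleftrightarrow> (\<forall>v \<in> carrier_vec n. qform A v \<le> qform B v)"

lemma form_leD: "form_le n A B \<Longrightarrow> v \<in> carrier_vec n \<Longrightarrow> qform A v \<le> qform B v"
  by (simp add: form_le_def)

lemma pd_matsD:
  assumes "A \<in> pd_mats n"
  shows "A \<in> herm_mats n" "A \<in> carrier_mat n n"
    "v \<in> carrier_vec n \<Longrightarrow> v \<noteq> 0\<^sub>v n \<Longrightarrow> 0 < qform A v"
  using assms by (auto simp: pd_mats_def herm_mats_def qform_def)

lemma pd_matsI:
  assumes "A \<in> herm_mats n" "\<And>v. v \<in> carrier_vec n \<Longrightarrow> v \<noteq> 0\<^sub>v n \<Longrightarrow> 0 < qform A v"
  shows "A \<in> pd_mats n"
  using assms by (auto simp: pd_mats_def qform_def)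

lemma qform_zero_vec: "A \<in> carrier_mat n n \<Longrightarrow> qform A (0\<^sub>v n) = 0"
  by (simp add: qform_def)

lemma pd_qform_nonneg: "A \<in> pd_mats n \<Longrightarrow> v \<in> carrier_vec n \<Longrightarrow> 0 \<le> qform A v"
  using pd_matsD(3)[of A n v] qform_zero_vec[OF pd_matsD(2)[of A n]]
  by (cases "v = 0\<^sub>v n") (auto intro: less_imp_le)

lemma pd_mult_vec_nonzero:
  assumes "A \<in> pd_mats n" "v \<in> carrier_vec n" "v \<noteq> 0\<^sub>v n"
  shows "A *\<^sub>v v \<noteq> 0\<^sub>v n"
  using pd_matsD(3)[OF assms] assms(2) by (auto simp: qform_def)

lemma spectral_mat_pd:
  assumes U: "U \<in> unitary_mats n" and f: "\<And>i. i < n \<Longrightarrow> 0 < f i"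
  shows "spectral_mat n U f \<in> pd_mats n"
proof (rule pd_matsI[OF spectral_mat_herm[OF U]])
  fix v :: "complex vec" assume v: "v \<in> carrier_vec n" "v \<noteq> 0\<^sub>v n"
  let ?a = "\<lambda>i. (cmod ((mat_adjoint U *\<^sub>v v) $ i))\<^sup>2"
  have "0 < (\<Sum>i<n. ?a i)"
    using sqnorm_pos[OF v] sqnorm_unitary_coords[OF U v(1)] by simp
  then obtain i where i: "i < n" "?a i > 0"
    by (metis sum_nonpos lessThan_iff not_less)
  have "0 < (\<Sum>i<n. f i * ?a i)"
    using i f by (intro sum_pos2[of _ i]) (auto simp: less_imp_le)
  then show "0 < qform (spectral_mat n U f) v"
    by (simp add: qform_spectral_mat[OF U v(1)])
qed

lemma spectral_mat_pdD:
  assumes U: "U \<in> unitary_mats n" and "spectral_mat n U f \<in> pd_mats n" and i: "i < n"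
  shows "0 < f i"
proof -
  have "col U i \<noteq> 0\<^sub>v n" using sqnorm_unitary_col[OF U i] by auto
  then show ?thesis
    using pd_matsD(3)[OF assms(2) unitary_col_carrier[OF U i]] qform_spectral_mat_col[OF U i]
    by simp
qed

lemma qform_le_if_eigenvalues_nonpos:
  assumes U: "U \<in> unitary_mats n" and "\<And>i. i < n \<Longrightarrow> f i \<le> 0" and v: "v \<in> carrier_vec n"
  shows "qform (spectral_mat n U f) v \<le> 0"
  unfolding qform_spectral_mat[OF U v] using assms(2)
  by (intro sum_nonpos) (auto intro: mult_nonpos_nonneg)

lemma form_le_antisym:
  assumes A: "A \<in> herm_mats n" and B: "B \<in> herm_mats n"
    and "form_le n A B" "form_le n B A"
  shows "A = B"
proof -
  note Ac = herm_matsD(1)[OF A] and Bc = herm_matsD(1)[OF B]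
  obtain U f where U: "U \<in> unitary_mats n" and D: "A - B = spectral_mat n U f"
    using hermitian_spectral_mat[OF herm_minus[OF A B]] by blast
  have "f i = 0" if i: "i < n" for i
  proof -
    have "f i = qform A (col U i) - qform B (col U i)"
      using qform_spectral_mat_col[OF U i, of f] qform_minus[OF Ac Bc unitary_col_carrier[OF U i]]
      unfolding D by simp
    then show ?thesis
      using assms(3,4) unitary_col_carrier[OF U i] by (simp add: form_le_def order_antisym)
  qed
  then have "mat_diag n (\<lambda>i. complex_of_real (f i)) = 0\<^sub>m n n"
    by (intro eq_matI) (auto simp: mat_diag_def)
  then have "A - B = 0\<^sub>m n n"
    using unitaryD(1)[OF U] unfolding D spectral_mat_def
    by (simp add: right_mult_zero_mat[of _ n n] left_mult_zero_mat[of _ n n])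
  have "A $$ (i, j) = B $$ (i, j)" if "i < n" "j < n" for i j
    using arg_cong[OF \<open>A - B = 0\<^sub>m n n\<close>, of "\<lambda>M. M $$ (i, j)"] that Ac Bc by simp
  then show ?thesis using Ac Bc by (intro eq_matI) auto
qed

text \<open>The square root is operator monotone: \<open>X\<^sup>2 \<le> N\<^sup>2\<close> implies \<open>X \<le> N\<close>. Otherwise \<open>X - N\<close> has
  an eigenvalue \<open>\<mu> > 0\<close>, with a unit eigenvector \<open>v\<close>; then \<open>X v = N v + \<mu> v\<close>, and since \<open>N\<close> is positive,
  the square of the length of \<open>X v\<close> exceeds that of \<open>N v\<close> by at least \<open>\<mu>\<^sup>2\<close>.\<close>
lemma form_le_of_sqnorm_le:
  assumes X: "X \<in> herm_mats n" and N: "N \<in> pd_mats n"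
    and le: "\<And>v. v \<in> carrier_vec n \<Longrightarrow> sqnorm (X *\<^sub>v v) \<le> sqnorm (N *\<^sub>v v)"
  shows "form_le n X N"
proof -
  note Xc = herm_matsD(1)[OF X] and Nh = pd_matsD(1)[OF N] and Nc = pd_matsD(2)[OF N]
  obtain U f where U: "U \<in> unitary_mats n" and D: "X - N = spectral_mat n U f"
    using hermitian_spectral_mat[OF herm_minus[OF X Nh]] by blast
  have "f i \<le> 0" if i: "i < n" for i
  proof (rule ccontr)
    assume "\<not> f i \<le> 0"
    then have pos: "f i > 0" by simp
    define v where "v = col U i"
    have v: "v \<in> carrier_vec n" unfolding v_def by (rule unitary_col_carrier[OF U i])
    have v1: "sqnorm v = 1" unfolding v_def by (rule sqnorm_unitary_col[OF U i])
    have Nv: "N *\<^sub>v v \<in> carrier_vec n" and Xv: "X *\<^sub>v v \<in> carrier_vec n"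
      using Nc Xc v by (auto intro: mult_mat_vec_carrier[of _ n n])
    have "X *\<^sub>v v - N *\<^sub>v v = complex_of_real (f i) \<cdot>\<^sub>v v"
      using spectral_mat_eigenvector[OF U i, of f] minus_mult_distrib_mat_vec[OF Xc Nc v]
      by (simp add: v_def flip: D)
    moreover have "X *\<^sub>v v = N *\<^sub>v v + (X *\<^sub>v v - N *\<^sub>v v)"
      using Nv Xv Nc Xc by (intro eq_vecI) auto
    ultimately have "X *\<^sub>v v = N *\<^sub>v v + complex_of_real (f i) \<cdot>\<^sub>v v" by simp
    then have "sqnorm (X *\<^sub>v v)
        = sqnorm (N *\<^sub>v v) + (f i)\<^sup>2 * sqnorm v + 2 * Re ((complex_of_real (f i) \<cdot>\<^sub>v v) \<bullet>c (N *\<^sub>v v))"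
      using Nv v by (simp add: sqnorm_add[of _ n] sqnorm_smult)
    also have "Re ((complex_of_real (f i) \<cdot>\<^sub>v v) \<bullet>c (N *\<^sub>v v)) = f i * qform N v"
      using v Nv by (simp add: qform_def herm_inner[OF Nh v v])
    finally have "(f i)\<^sup>2 + 2 * (f i * qform N v) \<le> 0"
      using le[OF v] by (simp add: v1)
    moreover have "0 \<le> f i * qform N v" using pos pd_qform_nonneg[OF N v] by simp
    ultimately show False using pos by (smt (verit) zero_less_power)
  qed
  then have "qform (X - N) v \<le> 0" if "v \<in> carrier_vec n" for v
    unfolding D using qform_le_if_eigenvalues_nonpos[OF U _ that] by simp
  then show ?thesis using qform_minus[OF Xc Nc] by (simp add: form_le_def)
qed

text \<open>Operator monotonicity of the square root, applied in both directions.\<close>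
lemma pd_sqrt_unique:
  assumes "B \<in> pd_mats n" "B' \<in> pd_mats n" "B * B = B' * B'"
  shows "B = B'"
proof -
  have "sqnorm (B *\<^sub>v v) = sqnorm (B' *\<^sub>v v)" if "v \<in> carrier_vec n" for v
    using qform_square[OF pd_matsD(1)[OF assms(1)] that] qform_square[OF pd_matsD(1)[OF assms(2)] that]
      assms(3) by simp
  then show ?thesis
    using assms by (intro form_le_antisym[of _ n] form_le_of_sqnorm_le) (auto dest: pd_matsD)
qed

lemma mat_sqrt:
  assumes "A \<in> pd_mats n"
  shows "mat_sqrt n A \<in> pd_mats n" "mat_sqrt n A * mat_sqrt n A = A"
proof -
  obtain U f where U: "U \<in> unitary_mats n" and A: "A = spectral_mat n U f"
    using hermitian_spectral_mat[OF pd_matsD(1)[OF assms]] by blast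
  have f: "0 < f i" if "i < n" for i
    using spectral_mat_pdD[OF U] assms that unfolding A by blast
  define B where "B = spectral_mat n U (\<lambda>i. sqrt (f i))"
  have "B \<in> pd_mats n" unfolding B_def using f by (intro spectral_mat_pd[OF U]) simp
  moreover have "B * B = A"
  proof -
    have "mat_diag n (\<lambda>i. complex_of_real (sqrt (f i) * sqrt (f i)))
        = mat_diag n (\<lambda>i. complex_of_real (f i))"
      using f by (intro eq_matI) (auto simp: mat_diag_def less_imp_le simp flip: of_real_mult)
    then show ?thesis unfolding B_def A spectral_mat_mult[OF U] by (simp add: spectral_mat_def)
  qed
  ultimately have "\<exists>!B. B \<in> pd_mats n \<and> B * B = A"
    using pd_sqrt_unique by blast
  from theI'[OF this] show "mat_sqrt n A \<in> pd_mats n" "mat_sqrt n A * mat_sqrt n A = A"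
    unfolding mat_sqrt_def by auto
qed

text \<open>The reciprocals of the eigenvalues give an inverse, so the elimination algorithm
  behind \<open>mat_inv\<close> succeeds.\<close>
lemma mat_inv_pd:
  assumes "A \<in> pd_mats n"
  shows "mat_inv A \<in> herm_mats n" "A * mat_inv A = 1\<^sub>m n" "mat_inv A * A = 1\<^sub>m n"
proof -
  note Ah = pd_matsD(1)[OF assms] and Ac = pd_matsD(2)[OF assms]
  obtain U f where U: "U \<in> unitary_mats n" and A: "A = spectral_mat n U f"
    using hermitian_spectral_mat[OF Ah] by blast
  have f: "f i \<noteq> 0" if "i < n" for i
    using spectral_mat_pdD[OF U, of f i] assms that unfolding A by auto
  have "A * spectral_mat n U (\<lambda>i. 1 / f i) = 1\<^sub>m n" "spectral_mat n U (\<lambda>i. 1 / f i) * A = 1\<^sub>m n"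
    unfolding A spectral_mat_mult[OF U] using f by (auto intro!: spectral_mat_one[OF U])
  moreover have "spectral_mat n U (\<lambda>i. 1 / f i) \<in> carrier_mat n n"
    by (rule herm_matsD(1)[OF spectral_mat_herm[OF U]])
  ultimately have "A \<in> Units (ring_mat TYPE(complex) n ())"
    using Ac by (auto simp: Units_def ring_mat_simps)
  then have "mat_inverse A \<noteq> None" using mat_inverse(1)[OF Ac, where b = "()"] by blast
  then obtain B where "mat_inverse A = Some B" by blast
  then have inv: "A * mat_inv A = 1\<^sub>m n" "mat_inv A * A = 1\<^sub>m n" "mat_inv A \<in> carrier_mat n n"
    using mat_inverse(2)[OF Ac] by (auto simp: mat_inv_def)
  have "mat_adjoint (mat_inv A) * A = 1\<^sub>m n"
    using mat_adjoint_mult[OF Ac inv(3)] inv(1) herm_matsD(2)[OF Ah] by simp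
  then have "mat_adjoint (mat_inv A) = mat_inv A"
    using assoc_mult_mat[of "mat_adjoint (mat_inv A)" n n A n "mat_inv A" n] inv Ac by simp
  then show "mat_inv A \<in> herm_mats n" using inv(3) by (simp add: herm_mats_def)
  show "A * mat_inv A = 1\<^sub>m n" "mat_inv A * A = 1\<^sub>m n" using inv by auto
qed

section \<open>The geometric mean as a maximum\<close>

text \<open>Positive semidefiniteness of the block matrix with rows \<open>(P, X)\<close> and \<open>(X, Q)\<close>, written as a
  form in two vectors so that no matrix of size \<open>2 n\<close> is needed. For Hermitian \<open>X\<close> the two off-diagonal terms are
  complex conjugates, which explains the factor 2.\<close>
definition block_nonneg :: "nat \<Rightarrow> complex mat \<Rightarrow> complex mat \<Rightarrow> complex mat \<Rightarrow> bool" where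
  "block_nonneg n P X Q \<longleftrightarrow> (\<forall>x \<in> carrier_vec n. \<forall>y \<in> carrier_vec n.
     0 \<le> qform P x + qform Q y + 2 * Re ((X *\<^sub>v y) \<bullet>c x))"

lemma block_nonneg_mono:
  assumes "block_nonneg n P X Q" "form_le n P P'" "form_le n Q Q'"
  shows "block_nonneg n P' X Q'"
  using assms unfolding block_nonneg_def form_le_def by (smt (verit))

text \<open>With \<open>S = P\<^sup>1\<^sup>/\<^sup>2\<close>, \<open>T = P\<^sup>-\<^sup>1\<^sup>/\<^sup>2\<close> and \<open>N\<close> the middle factor in the definition of
  \<open>P # Q\<close>, these are the only facts about the geometric mean on which the rest depends.\<close>
lemma geom_mean_factors:
  assumes P: "P \<in> pd_mats n" and Q: "Q \<in> pd_mats n"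
  obtains S T N where "S \<in> pd_mats n" "S * S = P" "T \<in> herm_mats n" "S * T = 1\<^sub>m n" "T * S = 1\<^sub>m n"
    "N \<in> pd_mats n" "N * N = T * Q * T" "geom_mean n P Q = S * N * S"
proof
  define S where "S = mat_sqrt n P"
  define T where "T = mat_inv S"
  show S: "S \<in> pd_mats n" and "S * S = P" using mat_sqrt[OF P] by (auto simp: S_def)
  show T: "T \<in> herm_mats n" and "S * T = 1\<^sub>m n" and TS: "T * S = 1\<^sub>m n"
    using mat_inv_pd[OF S] by (auto simp: T_def)
  note Tc = herm_matsD(1)[OF T] and Sc = pd_matsD(2)[OF S]
  have "T * Q * T \<in> pd_mats n"
  proof (rule pd_matsI)
    show "T * Q * T \<in> herm_mats n" by (rule herm_sandwich[OF pd_matsD(1)[OF Q] T])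
    fix v :: "complex vec" assume v: "v \<in> carrier_vec n" "v \<noteq> 0\<^sub>v n"
    have "S *\<^sub>v (T *\<^sub>v v) = v"
      using v(1) \<open>S * T = 1\<^sub>m n\<close> Sc Tc by (simp flip: assoc_mult_mat_vec[of _ n n _ n])
    moreover have "S *\<^sub>v 0\<^sub>v n = 0\<^sub>v n" using Sc by (intro eq_vecI) auto
    ultimately have "T *\<^sub>v v \<noteq> 0\<^sub>v n" using v(2) by auto
    then show "0 < qform (T * Q * T) v"
      using pd_matsD(3)[OF Q, of "T *\<^sub>v v"] Tc v(1)
      by (simp add: qform_sandwich[OF pd_matsD(2)[OF Q] T v(1)] mult_mat_vec_carrier[of _ n n])
  qed
  then show "mat_sqrt n (T * Q * T) \<in> pd_mats n"
    "mat_sqrt n (T * Q * T) * mat_sqrt n (T * Q * T) = T * Q * T"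
    by (rule mat_sqrt)+
  show "geom_mean n P Q = S * mat_sqrt n (T * Q * T) * S"
    by (simp add: geom_mean_def Let_def S_def T_def)
qed

lemma geom_mean_herm:
  assumes "P \<in> pd_mats n" "Q \<in> pd_mats n"
  shows "geom_mean n P Q \<in> herm_mats n"
proof -
  obtain S N where "S \<in> pd_mats n" "N \<in> pd_mats n" "geom_mean n P Q = S * N * S"
    using geom_mean_factors[OF assms] by metis
  then show ?thesis using herm_sandwich[of N n S] by (simp add: pd_matsD)
qed

text \<open>With \<open>P = S S\<close>, \<open>P # Q = S N S\<close> and \<open>Q = S N N S\<close>, the form is a perfect square,
  the squared length of \<open>S x + N S y\<close>.\<close>
lemma geom_mean_block_nonneg:
  assumes P: "P \<in> pd_mats n" and Q: "Q \<in> pd_mats n"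
  shows "block_nonneg n P (geom_mean n P Q) Q"
  unfolding block_nonneg_def
proof (intro ballI)
  fix x y :: "complex vec" assume x: "x \<in> carrier_vec n" and y: "y \<in> carrier_vec n"
  obtain S T N where S: "S \<in> pd_mats n" and SS: "S * S = P" and T: "T \<in> herm_mats n"
    and ST: "S * T = 1\<^sub>m n" and TS: "T * S = 1\<^sub>m n"
    and N: "N \<in> pd_mats n" and NN: "N * N = T * Q * T" and G: "geom_mean n P Q = S * N * S"
    using geom_mean_factors[OF assms] by metis
  note Sh = pd_matsD(1)[OF S] and Sc = pd_matsD(2)[OF S] and Tc = herm_matsD(1)[OF T]
    and Nc = pd_matsD(2)[OF N] and Qc = pd_matsD(2)[OF Q]
  note [simp] = mult_mat_vec_carrier[of _ n n]
  have "T *\<^sub>v (S *\<^sub>v y) = y"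
    using TS Sc Tc y by (simp flip: assoc_mult_mat_vec[of _ n n _ n])
  then have Qy: "qform Q y = sqnorm (N *\<^sub>v (S *\<^sub>v y))"
    using qform_square[OF pd_matsD(1)[OF N], of "S *\<^sub>v y"] qform_sandwich[OF Qc T, of "S *\<^sub>v y"]
      Sc y by (simp add: NN)
  have Px: "qform P x = sqnorm (S *\<^sub>v x)"
    using qform_square[OF Sh x] by (simp add: SS)
  have "(geom_mean n P Q *\<^sub>v y) \<bullet>c x = (N *\<^sub>v (S *\<^sub>v y)) \<bullet>c (S *\<^sub>v x)"
    unfolding G by (rule inner_sandwich[OF Nc Sh Sc y x])
  then have "qform P x + qform Q y + 2 * Re ((geom_mean n P Q *\<^sub>v y) \<bullet>c x)
      = sqnorm (S *\<^sub>v x + N *\<^sub>v (S *\<^sub>v y))"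
    using Sc Nc x y by (simp add: sqnorm_add[of _ n] Px Qy)
  then show "0 \<le> qform P x + qform Q y + 2 * Re ((geom_mean n P Q *\<^sub>v y) \<bullet>c x)"
    by (simp add: sqnorm_nonneg)
qed

text \<open>Multiplying by \<open>T\<close> on both sides turns \<open>P\<close> into \<open>I\<close>, \<open>Q\<close> into \<open>N\<^sup>2\<close> and \<open>X\<close> into
  \<open>Y = T X T\<close>. Semidefiniteness of the block matrix with rows \<open>(I, Y)\<close> and \<open>(Y, N\<^sup>2)\<close> gives \<open>Y\<^sup>2 \<le> N\<^sup>2\<close>, hence \<open>Y \<le> N\<close>;
  multiplying back by \<open>S\<close> gives \<open>X \<le> S N S = P # Q\<close>.\<close>
lemma geom_mean_greatest:
  assumes P: "P \<in> pd_mats n" and Q: "Q \<in> pd_mats n"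
    and X: "X \<in> herm_mats n" and block: "block_nonneg n P X Q"
  shows "form_le n X (geom_mean n P Q)"
proof -
  obtain S T N where S: "S \<in> pd_mats n" and SS: "S * S = P" and T: "T \<in> herm_mats n"
    and ST: "S * T = 1\<^sub>m n" and TS: "T * S = 1\<^sub>m n"
    and N: "N \<in> pd_mats n" and NN: "N * N = T * Q * T" and G: "geom_mean n P Q = S * N * S"
    using geom_mean_factors[OF P Q] by metis
  note Sh = pd_matsD(1)[OF S] and Sc = pd_matsD(2)[OF S] and Tc = herm_matsD(1)[OF T]
    and Nc = pd_matsD(2)[OF N] and Qc = pd_matsD(2)[OF Q] and Xc = herm_matsD(1)[OF X]
  note [simp] = mult_mat_vec_carrier[of _ n n]
  define Y where "Y = T * X * T"
  have Y: "Y \<in> herm_mats n" unfolding Y_def by (rule herm_sandwich[OF X T])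
  note Yc = herm_matsD(1)[OF Y]
  have ST_vec: "S *\<^sub>v (T *\<^sub>v w) = w" and TS_vec: "T *\<^sub>v (S *\<^sub>v w) = w" if "w \<in> carrier_vec n" for w
    using ST TS Sc Tc that by (simp_all flip: assoc_mult_mat_vec[of _ n n _ n])
  have "form_le n Y N"
  proof (rule form_le_of_sqnorm_le[OF Y N])
    fix w :: "complex vec" assume w: "w \<in> carrier_vec n"
    \<comment> \<open>in the rotated coordinates the test vectors are \<open>- Y w\<close> and \<open>w\<close>\<close>
    define x where "x = T *\<^sub>v (- (Y *\<^sub>v w))"
    have Yw: "Y *\<^sub>v w \<in> carrier_vec n" using Yc w by simp
    have neg: "- (Y *\<^sub>v w) = complex_of_real (-1) \<cdot>\<^sub>v (Y *\<^sub>v w)" by (intro eq_vecI) auto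
    have x: "x \<in> carrier_vec n" and Tw: "T *\<^sub>v w \<in> carrier_vec n" using Tc w Yw by (auto simp: x_def)
    have Px: "qform P x = sqnorm (Y *\<^sub>v w)"
      using qform_square[OF Sh x] sqnorm_smult[OF Yw, of "-1"] Yw
      by (simp add: SS x_def ST_vec neg del: of_real_minus)
    have Qy: "qform Q (T *\<^sub>v w) = sqnorm (N *\<^sub>v w)"
      using qform_square[OF pd_matsD(1)[OF N] w] qform_sandwich[OF Qc T w] by (simp add: NN)
    have "(X *\<^sub>v (T *\<^sub>v w)) \<bullet>c x = (Y *\<^sub>v w) \<bullet>c (- (Y *\<^sub>v w))"
      unfolding Y_def x_def using inner_sandwich[OF Xc T Tc w, of "- (T * X * T *\<^sub>v w)"] Yw
      by (simp add: Y_def)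
    also have "\<dots> = - complex_of_real (sqnorm (Y *\<^sub>v w))"
      by (simp add: inner_self uminus_conjugate_vec[symmetric])
    finally have "0 \<le> sqnorm (Y *\<^sub>v w) + sqnorm (N *\<^sub>v w) - 2 * sqnorm (Y *\<^sub>v w)"
      using block x Tw unfolding block_nonneg_def by (force simp: Px Qy)
    then show "sqnorm (Y *\<^sub>v w) \<le> sqnorm (N *\<^sub>v w)" by simp
  qed
  then have "qform Y (S *\<^sub>v v) \<le> qform N (S *\<^sub>v v)" if "v \<in> carrier_vec n" for v
    using that Sc by (simp add: form_le_def)
  moreover have "qform Y (S *\<^sub>v v) = qform X v" if "v \<in> carrier_vec n" for v
    using that Sc by (simp add: Y_def qform_sandwich[OF Xc T] TS_vec)
  moreover have "qform (geom_mean n P Q) v = qform N (S *\<^sub>v v)" if "v \<in> carrier_vec n" for v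
    unfolding G by (rule qform_sandwich[OF Nc Sh that])
  ultimately show ?thesis by (simp add: form_le_def)
qed

section \<open>The transform attached to a resolution of the identity\<close>

text \<open>The matrix of the theorem as a function of \<open>C\<close>. If \<open>R C R\<close> and \<open>(I - R) C (I - R)\<close> commute, it is
  the square of the sum of their square roots; this is why it reproduces multiples of the identity.\<close>
definition mean_compression :: "nat \<Rightarrow> complex mat \<Rightarrow> complex mat \<Rightarrow> complex mat" where
  "mean_compression n R C = R * C * R + (1\<^sub>m n - R) * C * (1\<^sub>m n - R)
     + 2 \<cdot>\<^sub>m geom_mean n (R * C * R) ((1\<^sub>m n - R) * C * (1\<^sub>m n - R))"

lemma pd_sandwich:
  assumes C: "C \<in> pd_mats n" and R: "R \<in> pd_mats n"
  shows "R * C * R \<in> pd_mats n"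
proof (rule pd_matsI)
  show "R * C * R \<in> herm_mats n"
    using herm_sandwich C R by (simp add: pd_matsD)
  fix v :: "complex vec" assume v: "v \<in> carrier_vec n" "v \<noteq> 0\<^sub>v n"
  have "R *\<^sub>v v \<in> carrier_vec n"
    using pd_matsD(2)[OF R] v(1) by (rule mult_mat_vec_carrier)
  then show "0 < qform (R * C * R) v"
    using pd_matsD(3)[OF C _ pd_mult_vec_nonzero[OF R v]]
    by (simp add: qform_sandwich[OF pd_matsD(2)[OF C] pd_matsD(1)[OF R] v(1)])
qed

lemma form_le_sandwich:
  assumes "C \<in> carrier_mat n n" "C' \<in> carrier_mat n n" "R \<in> herm_mats n" "form_le n C C'"
  shows "form_le n (R * C * R) (R * C' * R)"
  unfolding form_le_def
proof
  fix v :: "complex vec" assume v: "v \<in> carrier_vec n"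
  have "R *\<^sub>v v \<in> carrier_vec n"
    using herm_matsD(1)[OF assms(3)] v by (rule mult_mat_vec_carrier)
  then show "qform (R * C * R) v \<le> qform (R * C' * R) v"
    unfolding qform_sandwich[OF assms(1,3) v] qform_sandwich[OF assms(2,3) v]
    by (rule form_leD[OF assms(4)])
qed

lemma mean_compression_herm:
  assumes "R \<in> pd_mats n" "1\<^sub>m n - R \<in> pd_mats n" "C \<in> pd_mats n"
  shows "mean_compression n R C \<in> herm_mats n"
  unfolding mean_compression_def
  using assms herm_smult[of _ n 2]
  by (auto intro!: herm_add geom_mean_herm pd_sandwich intro: pd_matsD(1))

lemma qform_mean_compression:
  assumes "R \<in> pd_mats n" "1\<^sub>m n - R \<in> pd_mats n" "C \<in> pd_mats n" "v \<in> carrier_vec n"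
  shows "qform (mean_compression n R C) v
    = qform (R * C * R) v + qform ((1\<^sub>m n - R) * C * (1\<^sub>m n - R)) v
      + 2 * qform (geom_mean n (R * C * R) ((1\<^sub>m n - R) * C * (1\<^sub>m n - R))) v"
proof -
  note P = pd_sandwich[OF assms(3,1)] and Q = pd_sandwich[OF assms(3,2)]
  note G = herm_matsD(1)[OF geom_mean_herm[OF P Q]]
  show ?thesis
    unfolding mean_compression_def
    using qform_smult[OF G assms(4), of 2] pd_matsD(2)[OF P] pd_matsD(2)[OF Q] G assms(4)
    by (simp add: qform_add[of _ n])
qed

text \<open>Enlarging the diagonal blocks keeps a block matrix semidefinite, so the geometric mean
  for \<open>C\<close> competes in the maximum that characterizes the one for \<open>C'\<close>.\<close>
lemma mean_compression_mono:
  assumes R: "R \<in> pd_mats n" and S: "1\<^sub>m n - R \<in> pd_mats n"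
    and C: "C \<in> pd_mats n" and C': "C' \<in> pd_mats n" and le: "form_le n C C'"
  shows "form_le n (mean_compression n R C) (mean_compression n R C')"
proof -
  let ?P = "\<lambda>C. R * C * R" and ?Q = "\<lambda>C. (1\<^sub>m n - R) * C * (1\<^sub>m n - R)"
  note P = pd_sandwich[OF C R] and Q = pd_sandwich[OF C S]
    and P' = pd_sandwich[OF C' R] and Q' = pd_sandwich[OF C' S]
  have leP: "form_le n (?P C) (?P C')"
    by (rule form_le_sandwich[OF pd_matsD(2)[OF C] pd_matsD(2)[OF C'] pd_matsD(1)[OF R] le])
  have leQ: "form_le n (?Q C) (?Q C')"
    by (rule form_le_sandwich[OF pd_matsD(2)[OF C] pd_matsD(2)[OF C'] pd_matsD(1)[OF S] le])
  have "form_le n (geom_mean n (?P C) (?Q C)) (geom_mean n (?P C') (?Q C'))"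
    using geom_mean_block_nonneg[OF P Q] leP leQ
    by (intro geom_mean_greatest[OF P' Q' geom_mean_herm[OF P Q]]) (rule block_nonneg_mono)
  with leP leQ show ?thesis
    unfolding form_le_def
    by (force simp: qform_mean_compression[OF R S C] qform_mean_compression[OF R S C'])
qed

text \<open>With \<open>S = I - R\<close>, the competitor here is \<open>X = c R S\<close>, the geometric mean of
  \<open>c R\<^sup>2\<close> and \<open>c S\<^sup>2\<close>. It is Hermitian because \<open>R\<close> and \<open>S\<close> commute. The block form is at least \<open>c\<close> times
  the squared length of \<open>R x + S y\<close>, which is \<open>v\<close> for \<open>x = y = v\<close>.\<close>
lemma mean_compression_lower_bound:
  assumes R: "R \<in> pd_mats n" and S: "1\<^sub>m n - R \<in> pd_mats n" and C: "C \<in> pd_mats n"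
    and "0 \<le> c" and c: "\<And>v. v \<in> carrier_vec n \<Longrightarrow> c * sqnorm v \<le> qform C v" and v: "v \<in> carrier_vec n"
  shows "c * sqnorm v \<le> qform (mean_compression n R C) v"
proof -
  let ?S = "1\<^sub>m n - R"
  let ?P = "R * C * R" and ?Q = "?S * C * ?S"
  note P = pd_sandwich[OF C R] and Q = pd_sandwich[OF C S]
  note Rh = pd_matsD(1)[OF R] and Rc = pd_matsD(2)[OF R]
    and Sh = pd_matsD(1)[OF S] and Sc = pd_matsD(2)[OF S] and Cc = pd_matsD(2)[OF C]
  note [simp] = mult_mat_vec_carrier[of _ n n]
  define X where "X = complex_of_real c \<cdot>\<^sub>m (R * ?S)"
  have RS_eq: "R * ?S = R - R * R"
    using Rc by (simp add: mult_minus_distrib_mat[OF Rc one_carrier_mat Rc])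
  have RRh: "R * R \<in> herm_mats n" using herm_sandwich[OF herm_one Rh] Rc by simp
  have Xh: "X \<in> herm_mats n"
    unfolding X_def RS_eq by (intro herm_smult herm_minus Rh RRh)
  have RSc: "R * ?S \<in> carrier_mat n n" using Rc Sc by (rule mult_carrier_mat)
  have X_inner: "Re ((X *\<^sub>v y) \<bullet>c x) = c * Re ((?S *\<^sub>v y) \<bullet>c (R *\<^sub>v x))"
    if "x \<in> carrier_vec n" "y \<in> carrier_vec n" for x y
  proof -
    have "X *\<^sub>v y = complex_of_real c \<cdot>\<^sub>v (R *\<^sub>v (?S *\<^sub>v y))"
      unfolding X_def assoc_mult_mat_vec[OF Rc Sc that(2), symmetric]
      using RSc that(2) by (intro eq_vecI) auto
    then show ?thesis using that Rc Sc by (simp add: herm_inner[OF Rh])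
  qed
  have combine: "c * sqnorm (R *\<^sub>v x + ?S *\<^sub>v y)
      \<le> qform ?P x + qform ?Q y + 2 * Re ((X *\<^sub>v y) \<bullet>c x)"
    if x: "x \<in> carrier_vec n" and y: "y \<in> carrier_vec n" for x y
  proof -
    have "c * sqnorm (R *\<^sub>v x) \<le> qform ?P x" "c * sqnorm (?S *\<^sub>v y) \<le> qform ?Q y"
      using c[of "R *\<^sub>v x"] c[of "?S *\<^sub>v y"] Rc Sc x y
      by (simp_all add: qform_sandwich[OF Cc Rh] qform_sandwich[OF Cc Sh])
    then show ?thesis
      using Rc Sc x y by (simp add: sqnorm_add[of _ n] X_inner[OF x y] algebra_simps)
  qed
  have "block_nonneg n ?P X ?Q"
    unfolding block_nonneg_def using combine \<open>0 \<le> c\<close>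
    by (meson mult_nonneg_nonneg order_trans sqnorm_nonneg)
  then have "qform X v \<le> qform (geom_mean n ?P ?Q) v"
    using geom_mean_greatest[OF P Q Xh] v by (simp add: form_le_def)
  then have "c * sqnorm (R *\<^sub>v v + ?S *\<^sub>v v) \<le> qform (mean_compression n R C) v"
    using combine[OF v v] by (simp add: qform_mean_compression[OF R S C v] qform_def[of X])
  moreover have "R *\<^sub>v v + ?S *\<^sub>v v = v"
    using Rc v by (simp add: minus_mult_distrib_mat_vec[of _ n n]) (intro eq_vecI, auto)
  ultimately show ?thesis by simp
qed

text \<open>Let \<open>s = 1 - r\<close>. On \<open>v\<close> the two diagonal blocks are \<open>r\<^sup>2\<close> and \<open>s\<^sup>2\<close> times the form of
  \<open>C\<close>, so by the arithmetic of \<open>2 \<times> 2\<close> determinants the geometric mean contributes at most \<open>r s\<close> times that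
  form. The three coefficients add up to \<open>(r + s)\<^sup>2 = 1\<close>.\<close>
lemma qform_mean_compression_eigenvector:
  assumes R: "R \<in> pd_mats n" and S: "1\<^sub>m n - R \<in> pd_mats n" and C: "C \<in> pd_mats n"
    and v: "v \<in> carrier_vec n" "v \<noteq> 0\<^sub>v n" and ev: "R *\<^sub>v v = complex_of_real r \<cdot>\<^sub>v v"
  shows "qform (mean_compression n R C) v \<le> qform C v"
proof -
  let ?S = "1\<^sub>m n - R"
  let ?P = "R * C * R" and ?Q = "?S * C * ?S"
  define G where "G = geom_mean n ?P ?Q"
  define s where "s = 1 - r"
  note P = pd_sandwich[OF C R] and Q = pd_sandwich[OF C S]
  note Rh = pd_matsD(1)[OF R] and Rc = pd_matsD(2)[OF R]
    and Sh = pd_matsD(1)[OF S] and Sc = pd_matsD(2)[OF S] and Cc = pd_matsD(2)[OF C]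
  note Gc = herm_matsD(1)[OF geom_mean_herm[OF P Q], folded G_def]
  have evS: "?S *\<^sub>v v = complex_of_real s \<cdot>\<^sub>v v"
    using Rc v ev by (simp add: minus_mult_distrib_mat_vec[of _ n n] s_def)
      (intro eq_vecI, auto simp: algebra_simps)
  have "0 < r" "0 < s"
    using pd_matsD(3)[OF R v] pd_matsD(3)[OF S v] sqnorm_pos[OF v]
    by (simp_all add: qform_eigenvector[OF ev] qform_eigenvector[OF evS] zero_less_mult_iff)
  have Pv: "qform ?P v = r\<^sup>2 * qform C v" and Qv: "qform ?Q v = s\<^sup>2 * qform C v"
    using qform_sandwich[OF Cc Rh v(1)] qform_sandwich[OF Cc Sh v(1)]
    by (simp_all add: ev evS qform_smult_vec[OF Cc v(1)])
  \<comment> \<open>these multiples make the two diagonal terms equal, so the estimate for the mean is sharp\<close>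
  let ?x = "complex_of_real (- s) \<cdot>\<^sub>v v" and ?y = "complex_of_real r \<cdot>\<^sub>v v"
  have "0 \<le> qform ?P ?x + qform ?Q ?y + 2 * Re ((G *\<^sub>v ?y) \<bullet>c ?x)"
    using geom_mean_block_nonneg[OF P Q] v(1) unfolding block_nonneg_def G_def
    by (metis smult_carrier_vec)
  also have "(G *\<^sub>v ?y) \<bullet>c ?x = complex_of_real (- (r * s)) * ((G *\<^sub>v v) \<bullet>c v)"
    using Gc v(1) mult_mat_vec_carrier[OF Gc v(1)]
    by (simp add: mult_mat_vec[of _ n n] conjugate_smult_vec)
  also have "qform ?P ?x + qform ?Q ?y + 2 * Re (complex_of_real (- (r * s)) * ((G *\<^sub>v v) \<bullet>c v))
      = 2 * (r * s) * (r * s * qform C v - qform G v)"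
    by (simp only: qform_smult_vec[OF pd_matsD(2)[OF P] v(1)] qform_smult_vec[OF pd_matsD(2)[OF Q] v(1)]
        Pv Qv) (simp add: qform_def[of G] power2_eq_square algebra_simps)
  finally have "qform G v \<le> r * s * qform C v"
    using mult_pos_pos[OF \<open>0 < r\<close> \<open>0 < s\<close>] by (auto simp: zero_le_mult_iff)
  then have "qform (mean_compression n R C) v \<le> (r\<^sup>2 + s\<^sup>2 + 2 * (r * s)) * qform C v"
    by (simp add: qform_mean_compression[OF R S C v(1)] Pv Qv G_def algebra_simps)
  also have "r\<^sup>2 + s\<^sup>2 + 2 * (r * s) = 1" by (simp add: s_def power2_eq_square algebra_simps)
  finally show ?thesis by simp
qed

text \<open>Summing the bound at eigenvectors over an eigenbasis of \<open>R\<close> compares the traces; the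
  bases \<open>U\<close> and \<open>V\<close> are left arbitrary because each side is needed in a different basis.\<close>
lemma trace_mean_compression_le:
  assumes R: "R \<in> pd_mats n" and S: "1\<^sub>m n - R \<in> pd_mats n" and C: "C \<in> pd_mats n"
    and U: "U \<in> unitary_mats n" and V: "V \<in> unitary_mats n"
  shows "(\<Sum>i<n. qform (mean_compression n R C) (col U i)) \<le> (\<Sum>i<n. qform C (col V i))"
proof -
  obtain W r where W: "W \<in> unitary_mats n" and R_eq: "R = spectral_mat n W r"
    using hermitian_spectral_mat[OF pd_matsD(1)[OF R]] by blast
  note Hc = herm_matsD(1)[OF mean_compression_herm[OF R S C]]
  have "(\<Sum>i<n. qform (mean_compression n R C) (col U i))
      = (\<Sum>i<n. qform (mean_compression n R C) (col W i))"
    by (simp add: trace_unitary_basis[OF Hc U] trace_unitary_basis[OF Hc W])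
  also have "\<dots> \<le> (\<Sum>i<n. qform C (col W i))"
  proof (rule sum_mono)
    fix i assume "i \<in> {..<n}"
    then have i: "i < n" by simp
    have "col W i \<noteq> 0\<^sub>v n" using sqnorm_unitary_col[OF W i] by auto
    moreover have "R *\<^sub>v col W i = complex_of_real (r i) \<cdot>\<^sub>v col W i"
      unfolding R_eq by (rule spectral_mat_eigenvector[OF W i])
    ultimately show "qform (mean_compression n R C) (col W i) \<le> qform C (col W i)"
      using qform_mean_compression_eigenvector[OF R S C unitary_col_carrier[OF W i]] by blast
  qed
  also have "\<dots> = (\<Sum>i<n. qform C (col V i))"
    by (simp add: trace_unitary_basis[OF pd_matsD(2)[OF C] W] trace_unitary_basis[OF pd_matsD(2)[OF C] V])
  finally show ?thesis .
qed

section \<open>Weak majorization\<close>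

lemma decreasing_eigvals_desc [simp]: "decreasing (eigvals_desc A) = eigvals_desc A"
  unfolding decreasing_def eigvals_desc_def by (subst properties_for_sort) auto

text \<open>With \<open>C'\<close> obtained by raising the eigenvalues of \<open>C\<close> to at least its \<open>k\<close>-th eigenvalue \<open>c\<close>,
  the bound \<open>tr C' - (n - k) c\<close> from trace and lower bound is exactly the sum of the \<open>k\<close> largest
  eigenvalues of \<open>C\<close>.\<close>
lemma mean_compression_partial_sum_le:
  assumes R: "R \<in> pd_mats n" and S: "1\<^sub>m n - R \<in> pd_mats n" and C: "C \<in> pd_mats n"
    and W: "W \<in> unitary_mats n" and k: "1 \<le> k" "k \<le> n"
  shows "(\<Sum>j<k. qform (mean_compression n R C) (col W j)) \<le> (\<Sum>j<k. eigvals_desc C ! j)"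
proof -
  let ?F = "mean_compression n R"
  define l where "l j = eigvals_desc C ! j" for j
  note ev = eigvals_desc_spectral[OF pd_matsD(1)[OF C]]
  obtain U where U: "U \<in> unitary_mats n" and C_eq: "C = spectral_mat n U l"
    using ev(3) by (auto simp: l_def[abs_def])
  have dec: "l j \<le> l i" if "i \<le> j" "j < n" for i j
    using sorted_wrt_nth_less[OF ev(2), of i j] that ev(1) by (cases "i = j") (auto simp: l_def)
  have pos: "0 < l j" if "j < n" for j
    using spectral_mat_pdD[OF U _ that] C unfolding C_eq by blast
  \<comment> \<open>list positions start at 0, so this is the \<open>k\<close>-th largest eigenvalue\<close>
  define c where "c = l (k - 1)"
  have c0: "0 \<le> c" using pos[of "k - 1"] k by (simp add: c_def less_imp_le)
  define C' where "C' = spectral_mat n U (\<lambda>j. max (l j) c)"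
  have C': "C' \<in> pd_mats n"
    unfolding C'_def using pos by (intro spectral_mat_pd[OF U]) (simp add: less_max_iff_disj)
  have le: "form_le n C C'"
    unfolding form_le_def C_eq C'_def
    by (auto simp: qform_spectral_mat[OF U] intro!: sum_mono mult_right_mono)
  have "c * sqnorm v \<le> qform C' v" if "v \<in> carrier_vec n" for v
    unfolding C'_def qform_spectral_mat[OF U that] sqnorm_unitary_coords[OF U that] sum_distrib_left
    by (intro sum_mono mult_right_mono) auto
  then have lower: "c \<le> qform (?F C') (col W j)" if "j < n" for j
    using mean_compression_lower_bound[OF R S C', of c "col W j"] that c0
    by (simp add: unitary_col_carrier[OF W] sqnorm_unitary_col[OF W])
  have split: "(\<Sum>j<n. f j) = (\<Sum>j<k. f j) + (\<Sum>j\<in>{k..<n}. f j)" for f :: "nat \<Rightarrow> real"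
    using k sum.atLeastLessThan_concat[of 0 k n f] by (simp add: atLeast0LessThan)
  have "(\<Sum>j<k. qform (?F C) (col W j)) \<le> (\<Sum>j<k. qform (?F C') (col W j))"
    using k by (intro sum_mono form_leD[OF mean_compression_mono[OF R S C C' le]]
        unitary_col_carrier[OF W]) simp
  also have "\<dots> \<le> (\<Sum>j<n. qform (?F C') (col W j)) - (\<Sum>j\<in>{k..<n}. c)"
    using sum_mono[of "{k..<n}" "\<lambda>_. c" "\<lambda>j. qform (?F C') (col W j)"] lower
    by (simp add: split)
  also have "(\<Sum>j<n. qform (?F C') (col W j)) \<le> (\<Sum>j<n. qform C' (col U j))"
    by (rule trace_mean_compression_le[OF R S C' W U])
  also have "(\<Sum>j<n. qform C' (col U j)) = (\<Sum>j<n. max (l j) c)"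
    by (simp add: C'_def qform_spectral_mat_col[OF U])
  also have "\<dots> - (\<Sum>j\<in>{k..<n}. c) = (\<Sum>j<k. l j)"
  proof -
    have "(\<Sum>j<k. max (l j) c) = (\<Sum>j<k. l j)"
      using k dec[of _ "k - 1"] by (intro sum.cong) (auto simp: c_def max_absorb1)
    moreover have "(\<Sum>j\<in>{k..<n}. max (l j) c) = (\<Sum>j\<in>{k..<n}. c)"
      using k dec[of "k - 1"] by (intro sum.cong) (auto simp: c_def max_absorb2)
    ultimately show ?thesis by (simp add: split)
  qed
  finally show ?thesis by (simp add: l_def)
qed

theorem theorem4p2:
  fixes n :: nat and C R :: "complex mat"
  assumes "C \<in> pd_mats n"
    and "R \<in> pd_mats n"
    and "loewner_less n (0\<^sub>m n n) R"
    and "loewner_less n R (1\<^sub>m n)"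
  shows "eigvals_desc
           (R * C * R + (1\<^sub>m n - R) * C * (1\<^sub>m n - R)
            + 2 \<cdot>\<^sub>m geom_mean n (R * C * R) ((1\<^sub>m n - R) * C * (1\<^sub>m n - R)))
         \<prec>\<^sub>w eigvals_desc C"
proof -
  have S: "1\<^sub>m n - R \<in> pd_mats n" using assms(4) by (simp add: loewner_less_def)
  define H where "H = mean_compression n R C"
  have H: "H \<in> herm_mats n"
    unfolding H_def by (rule mean_compression_herm[OF assms(2) S assms(1)])
  note ev = eigvals_desc_spectral[OF H]
  obtain W where W: "W \<in> unitary_mats n" and H_eq: "H = spectral_mat n W (\<lambda>j. eigvals_desc H ! j)"
    using ev(3) by blast
  have "(\<Sum>j<k. eigvals_desc H ! j) \<le> (\<Sum>j<k. eigvals_desc C ! j)" if k: "1 \<le> k" "k \<le> n" for k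
  proof -
    have "(\<Sum>j<k. eigvals_desc H ! j) = (\<Sum>j<k. qform H (col W j))"
      using k by (subst H_eq) (simp add: qform_spectral_mat_col[OF W])
    then show ?thesis
      using mean_compression_partial_sum_le[OF assms(2) S assms(1) W k] by (simp add: H_def)
  qed
  then have "eigvals_desc H \<prec>\<^sub>w eigvals_desc C"
    using ev(1) eigvals_desc_spectral(1)[OF pd_matsD(1)[OF assms(1)]]
    by (simp add: weakly_majorized_def)
  then show ?thesis by (simp add: H_def mean_compression_def)
qed

end
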